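(* Let $\mathbb{N}$ be the set of non-negative integers, $\mathcal{Y}$ a $q$-algebra of subsets of $\mathbb{N}$, and $\pi$ a density on $\mathcal{Y}$. If $\pi$ has the Darboux property on $\mathcal{Y}$, then for every compact metric space $\mathcal{M}$ with a Borel probability measure $\tilde{P}$ there exists a $\pi$-uniformly measurable mapping $x:\mathbb{N}\to\mathcal{M}$.
   Context: A system $\mathcal{Y}$ of subsets of $\mathbb{N}$ is a $q$-algebra of sets if: (i) $\mathbb{N}\in\mathcal{Y}$; (ii) $A,B\in\mathcal{Y}$ and $A\cap B=\emptyset$ imply $A\cup B\in\mathcal{Y}$; (iii) $A,B\in\mathcal{Y}$ and $A\subset B$ imply $B\setminus A\in\mathcal{Y}$. A density on $\mathcal{Y}$ is a finitely additive probability measure $\pi$ on $\mathcal{Y}$ such that a set $A\subset\mathbb{N}$ belongs to $\mathcal{Y}$ if and only if for every $\varepsilon>0$ there exist $A_1,A_2\in\mathcal{Y}$ with $A_1\subset A\subset A_2$ and $\pi(A_2)-\pi(A_1)<\varepsilon$. $\pi$ has the Darboux property on $\mathcal{Y}$ if for every $A\in\mathcal{Y}$ and every non-negative $\alpha\le\pi(A)$ there exists $B\subset A$, $B\in\mathcal{Y}$, with $\pi(B)=\alpha$. A measurable set $A\subset\mathcal{M}$ is a set of $\tilde{P}$-continuity if $\tilde{P}(cl(A)\setminus Int(A))=0$, with closure and interior taken in $\mathcal{M}$. A mapping $y:\mathbb{N}\to\mathcal{M}$ is $\pi$-uniformly measurable if for every set of $\tilde{P}$-continuity $A\subset\mathcal{M}$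 we have $y^{-1}(A)\in\mathcal{Y}$ and $\pi(y^{-1}(A))=\tilde{P}(A)$. *)

theory Defs
  imports "HOL-Probability.Probability"
begin

definition q_algebra :: "nat set set \<Rightarrow> bool" where
  "q_algebra Y \<longleftrightarrow>
     UNIV \<in> Y \<and>
     (\<forall>A\<in>Y. \<forall>B\<in>Y. A \<inter> B = {} \<longrightarrow> A \<union> B \<in> Y) \<and>
     (\<forall>A\<in>Y. \<forall>B\<in>Y. A \<subseteq> B \<longrightarrow> B - A \<in> Y)"

text \<open>Set functions are total in HOL; only the values on \<open>Y\<close> are constrained or used.\<close>

definition fin_add_prob :: "nat set set \<Rightarrow> (nat set \<Rightarrow> real) \<Rightarrow> bool" where
  "fin_add_prob Y \<pi> \<longleftrightarrow> (\<forall>A\<in>Y. 0 \<le> \<pi> A) \<and> \<pi> UNIV = 1 \<and> additive Y \<pi>"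

definition density_on :: "nat set set \<Rightarrow> (nat set \<Rightarrow> real) \<Rightarrow> bool" where
  "density_on Y \<pi> \<longleftrightarrow>
     fin_add_prob Y \<pi> \<and>
     (\<forall>A. A \<in> Y \<longleftrightarrow>
        (\<forall>\<epsilon>>0. \<exists>A1\<in>Y. \<exists>A2\<in>Y. A1 \<subseteq> A \<and> A \<subseteq> A2 \<and> \<pi> A2 - \<pi> A1 < \<epsilon>))"

definition darboux_on :: "nat set set \<Rightarrow> (nat set \<Rightarrow> real) \<Rightarrow> bool" where
  "darboux_on Y \<pi> \<longleftrightarrow>
     (\<forall>A\<in>Y. \<forall>\<alpha>. 0 \<le> \<alpha> \<and> \<alpha> \<le> \<pi> A \<longrightarrow> (\<exists>B\<in>Y. B \<subseteq> A \<and> \<pi> B = \<alpha>))"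

text \<open>The library's \<^const>\<open>borel\<close> lives on whole types; this is its analogue for
  a topology with an arbitrary carrier.\<close>

definition borel_of :: "'a topology \<Rightarrow> 'a measure" where
  "borel_of X = sigma (topspace X) {U. openin X U}"

definition continuity_set :: "'a topology \<Rightarrow> 'a measure \<Rightarrow> 'a set \<Rightarrow> bool" where
  "continuity_set X P A \<longleftrightarrow>
     A \<in> sets P \<and> measure P (X closure_of A - X interior_of A) = 0"

definition uniformly_measurable ::
  "nat set set \<Rightarrow> (nat set \<Rightarrow> real) \<Rightarrow> 'a topology \<Rightarrow> 'a measure \<Rightarrow> (nat \<Rightarrow> 'a) \<Rightarrow> bool" where
  "uniformly_measurable Y \<pi> X P y \<longleftrightarrow>
     y \<in> UNIV \<rightarrow> topspace X \<and>
     (\<forall>A. continuity_set X P A \<longrightarrow> y -` A \<in> Y \<and> \<pi> (y -` A) = measure P A)"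

end

theory Submission
  imports Defs
begin

text \<open>Take balls \<open>B\<^sub>0, B\<^sub>1, \<dots>\<close> of \<open>\<M>\<close> such that for every \<open>e\<close> finitely many of those of radius
  below \<open>e\<close> cover \<open>\<M>\<close>. Successive cutting by the \<open>B\<^sub>n\<close> yields a binary tree of Borel cells, and
  the Darboux property yields a parallel tree of sets of \<open>Y\<close> with the same masses. By
  compactness the closures of the cells that belong to the sets containing \<open>k\<close> have a common
  point \<open>x k\<close>. At a level where the cells are small, the sets whose closed cells lie in \<open>A\<close>,
  respectively meet \<open>A\<close>, bound the preimage of \<open>A\<close> from below and above. They differ only in cells
  near the boundary of \<open>A\<close>, which have small total mass if \<open>A\<close> is a continuity set.\<close>

section \<open>Finite additivity on a q-algebra\<close>

lemma q_algebra_empty: "q_algebra Y \<Longrightarrow> {} \<in> Y"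
  unfolding q_algebra_def by (metis Diff_cancel subset_refl)

lemma fin_add_prob_empty:
  assumes "q_algebra Y" "fin_add_prob Y \<pi>"
  shows "\<pi> {} = 0"
  using assms q_algebra_empty[OF assms(1)] additiveD[of Y \<pi> "{}" "{}"]
  by (simp add: fin_add_prob_def)

lemma fin_add_prob_diff:
  assumes "q_algebra Y" "fin_add_prob Y \<pi>" "A \<in> Y" "B \<in> Y" "A \<subseteq> B"
  shows "\<pi> (B - A) = \<pi> B - \<pi> A"
proof -
  have "B - A \<in> Y"
    using assms by (simp add: q_algebra_def)
  moreover have "A \<inter> (B - A) = {}" "A \<union> (B - A) = B"
    using assms(5) by auto
  ultimately show ?thesis
    using assms additiveD[of Y \<pi> A "B - A"] by (simp add: fin_add_prob_def)
qed

lemma fin_add_prob_mono: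
  assumes "q_algebra Y" "fin_add_prob Y \<pi>" "A \<in> Y" "B \<in> Y" "A \<subseteq> B"
  shows "\<pi> A \<le> \<pi> B"
proof -
  have "B - A \<in> Y"
    using assms by (simp add: q_algebra_def)
  then have "0 \<le> \<pi> (B - A)"
    using assms by (simp add: fin_add_prob_def)
  then show ?thesis
    using fin_add_prob_diff[OF assms] by simp
qed

text \<open>A q-algebra is closed under disjoint unions only, so disjointness is needed to keep the
  partial unions in \<open>Y\<close>, not just to add up masses.\<close>

lemma fin_add_prob_UN:
  assumes Y: "q_algebra Y" "fin_add_prob Y \<pi>"
    and "finite I" "\<And>i. i \<in> I \<Longrightarrow> F i \<in> Y" "disjoint_family_on F I"
  shows "(\<Union>i\<in>I. F i) \<in> Y \<and> \<pi> (\<Union>i\<in>I. F i) = (\<Sum>i\<in>I. \<pi> (F i))"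
  using assms(3-)
proof (induction I rule: finite_induct)
  case empty
  then show ?case
    using q_algebra_empty fin_add_prob_empty Y by simp
next
  case (insert i I)
  have "disjoint_family_on F I"
    using insert.prems(2) by (auto simp: disjoint_family_on_def)
  then have IH: "(\<Union>i\<in>I. F i) \<in> Y" "\<pi> (\<Union>i\<in>I. F i) = (\<Sum>i\<in>I. \<pi> (F i))"
    using insert by auto
  have disj: "F i \<inter> (\<Union>i\<in>I. F i) = {}"
    using insert.prems(2) insert.hyps(2) by (fastforce simp: disjoint_family_on_def)
  have "F i \<in> Y"
    using insert by simp
  then show ?case
    using Y disj IH additiveD[OF _ disj, of Y \<pi>] insert.hyps
    by (simp add: q_algebra_def fin_add_prob_def)
qed

section \<open>Parallel binary trees of cells and of sets in \<open>Y\<close>\<close>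

text \<open>The most recent decision is at the head of the list, so the tail of a node is its parent.\<close>

primrec branch :: "(bool list \<Rightarrow> 'b set \<Rightarrow> 'b set) \<Rightarrow> 'b set \<Rightarrow> bool list \<Rightarrow> 'b set" where
  "branch h S [] = S"
| "branch h S (b # s) =
     (if b then branch h S s \<inter> h s (branch h S s) else branch h S s - h s (branch h S s))"

lemma branch_subset: "branch h S s \<subseteq> S"
  by (induction s) auto

lemma branch_disjoint:
  "length s = length t \<Longrightarrow> s \<noteq> t \<Longrightarrow> branch h S s \<inter> branch h S t = {}"
proof (induction s t rule: list_induct2)
  case (Cons b s c t)
  then show ?case
    by (cases "s = t") (auto split: if_splits)
qed simp

lemma disjoint_family_on_branch:
  assumes "I \<subseteq> {s. length s = n}"
  shows "disjoint_family_on (branch h S) I"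
  unfolding disjoint_family_on_def
proof (intro ballI impI)
  fix s t assume "s \<in> I" "t \<in> I" "s \<noteq> t"
  then show "branch h S s \<inter> branch h S t = {}"
    using assms by (intro branch_disjoint) auto
qed

lemma branch_cover: "x \<in> S \<Longrightarrow> \<exists>s. length s = n \<and> x \<in> branch h S s"
proof (induction n)
  case (Suc n)
  then obtain s where s: "length s = n" "x \<in> branch h S s"
    by blast
  then have "length ((x \<in> h s (branch h S s)) # s) = Suc n"
    "x \<in> branch h S ((x \<in> h s (branch h S s)) # s)"
    by auto
  then show ?case by blast
qed simp

lemma finite_bool_lists: "finite {s :: bool list. length s = n}"
  using finite_lists_length_eq[of "UNIV :: bool set" n] by simp

text \<open>A nonempty node must have a nonempty cell, even when the latter is null; otherwise
  the numbers passing through it could not be assigned a value.\<close>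

lemma darboux_tree:
  fixes C :: "bool list \<Rightarrow> 'a set"
  assumes Y: "q_algebra Y" "fin_add_prob Y \<pi>" "darboux_on Y \<pi>"
    and P: "prob_space P" and C_meas: "\<And>s. C s \<in> sets P" and C_Nil: "C [] = space P"
    and C_split: "\<And>s. C s = C (True # s) \<union> C (False # s)"
    and C_disj: "\<And>s. C (True # s) \<inter> C (False # s) = {}"
  obtains h where "\<And>s. branch h UNIV s \<in> Y"
    "\<And>s. \<pi> (branch h UNIV s) = measure P (C s)"
    "\<And>s. C s = {} \<Longrightarrow> branch h UNIV s = {}"
proof -
  interpret prob_space P by fact
  have C_add: "measure P (C s) = measure P (C (True # s)) + measure P (C (False # s))" for s
    using finite_measure_Union[OF C_meas C_meas C_disj] C_split by metis
  define good where "good s S \<longleftrightarrow> S \<in> Y \<and> \<pi> S = measure P (C s) \<and> (C s = {} \<longrightarrow> S = {})" for s S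
  have ex: "\<exists>T. T \<subseteq> S \<and> good (True # s) T \<and> good (False # s) (S - T)" if S: "good s S" for s S
  proof -
    have SY: "S \<in> Y" "\<pi> S = measure P (C s)" and SE: "C s = {} \<Longrightarrow> S = {}"
      using S by (auto simp: good_def)
    consider "C (True # s) = {}" | "C (False # s) = {}"
      | "C (True # s) \<noteq> {}" "C (False # s) \<noteq> {}" by blast
    then show ?thesis
    proof cases
      \<comment> \<open>With an empty half-cell, all of \<open>S\<close> must go to the other child:
        the Darboux property might select a nonempty set of mass 0 for the empty one.\<close>
      case 1
      have "C (False # s) = C s"
        using C_split[of s] 1 by simp
      then have "good (True # s) {}" "good (False # s) (S - {})"
        using 1 S q_algebra_empty[OF Y(1)] fin_add_prob_empty[OF Y(1,2)]
        by (auto simp: good_def)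
      then show ?thesis by blast
    next
      case 2
      have "C (True # s) = C s"
        using C_split[of s] 2 by simp
      then have "good (True # s) S" "good (False # s) (S - S)"
        using 2 S q_algebra_empty[OF Y(1)] fin_add_prob_empty[OF Y(1,2)]
        by (auto simp: good_def)
      then show ?thesis by blast
    next
      case 3
      have "measure P (C (True # s)) \<le> \<pi> S"
        using C_add[of s] SY(2) by simp
      then obtain T where T: "T \<in> Y" "T \<subseteq> S" "\<pi> T = measure P (C (True # s))"
        using Y(3) SY(1) measure_nonneg[of P] unfolding darboux_on_def by metis
      have "S - T \<in> Y"
        using Y(1) SY(1) T by (simp add: q_algebra_def)
      then show ?thesis
        using T 3 SY fin_add_prob_diff[OF Y(1,2) T(1) SY(1) T(2)] C_add[of s]
        by (auto simp: good_def)
    qed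
  qed
  \<comment> \<open>The cut is chosen from the set \<open>S\<close> actually reached. The choice is
    meaningful only for good \<open>S\<close>, which the induction along the tree supplies.\<close>
  define h where "h s S = (SOME T. T \<subseteq> S \<and> good (True # s) T \<and> good (False # s) (S - T))" for s S
  have h: "h s S \<subseteq> S \<and> good (True # s) (h s S) \<and> good (False # s) (S - h s S)" if "good s S" for s S
    unfolding h_def using someI_ex[OF ex[OF that]] .
  have "good s (branch h UNIV s)" for s
  proof (induction s)
    \<comment> \<open>The root contains every number, so its cell must be nonempty; a space carrying
      a probability measure is.\<close>
    case Nil
    show ?case
      using Y(1,2) C_Nil prob_space subprob_not_empty
      by (simp add: good_def q_algebra_def fin_add_prob_def)
  next
    case (Cons b s)
    then show ?case
      using h[OF Cons.IH] by (cases b) (auto simp: Int_absorb1)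
  qed
  then show ?thesis
    using that unfolding good_def by blast
qed

section \<open>Balls and boundaries in a metric space\<close>

lemma borel_of_sets_openin: "openin X U \<Longrightarrow> U \<in> sets (borel_of X)"
  unfolding borel_of_def using openin_subset by (subst sets_measure_of) auto

lemma space_borel_of: "space (borel_of X) = topspace X"
  unfolding borel_of_def by (rule space_measure_of) (auto dest: openin_subset)

context Metric_space
begin

text \<open>By total boundedness finitely many balls of radius \<open>1 / Suc m\<close> cover
  \<open>M\<close>, for every \<open>m\<close>. Enumerate all of them in one sequence: each finite
  cover appears within an initial segment, so \<open>N\<close> is uniform in
  \<open>p\<close>.\<close>

lemma compact_ball_sequence:
  assumes "compact_space mtopology" "M \<noteq> {}"
  obtains r :: "nat \<Rightarrow> real" and c :: "nat \<Rightarrow> 'a"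
  where "\<forall>e>0. \<exists>N. \<forall>p\<in>M. \<exists>n<N. r n < e \<and> p \<in> mball (c n) (r n)"
proof -
  have "mtotally_bounded M"
    using assms(1) compactin_imp_mtotally_bounded by (simp add: compact_space_def)
  then have "\<exists>K. finite K \<and> K \<subseteq> M \<and> M \<subseteq> (\<Union>x\<in>K. mball x (1 / real (Suc m)))" for m
    by (simp add: mtotally_bounded_def)
  then obtain K where K: "\<And>m. finite (K m)" "\<And>m. M \<subseteq> (\<Union>x\<in>K m. mball x (1 / real (Suc m)))"
    by metis
  define S where "S = (\<Union>m. K m \<times> {1 / real (Suc m)})"
  have "countable S"
    unfolding S_def using K(1) by (auto intro: countable_finite)
  \<comment> \<open>\<open>from_nat_into\<close> enumerates exactly \<open>S\<close> only if
    \<open>S\<close> is nonempty; here \<open>M\<close> being nonempty enters.\<close>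
  moreover have "S \<noteq> {}"
    unfolding S_def using K(2)[of 0] assms(2) by auto
  ultimately have rng: "range (from_nat_into S) = S"
    by (rule range_from_nat_into[rotated])
  have "\<exists>N. \<forall>p\<in>M. \<exists>n<N. snd (from_nat_into S n) < e
      \<and> p \<in> mball (fst (from_nat_into S n)) (snd (from_nat_into S n))" if "e > 0" for e
  proof -
    obtain m where m: "1 / real (Suc m) < e"
      using \<open>e > 0\<close> nat_approx_posE by blast
    have "K m \<times> {1 / real (Suc m)} \<subseteq> range (from_nat_into S)"
      unfolding rng unfolding S_def by blast
    then obtain J where J: "finite J" "K m \<times> {1 / real (Suc m)} = from_nat_into S ` J"
      using K(1)[of m] finite_subset_image[of "K m \<times> {1 / real (Suc m)}" "from_nat_into S" UNIV]
      by auto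
    obtain N where N: "\<forall>n\<in>J. n < N"
      using J(1) finite_nat_set_iff_bounded by blast
    have "\<exists>n<N. snd (from_nat_into S n) < e
      \<and> p \<in> mball (fst (from_nat_into S n)) (snd (from_nat_into S n))" if p: "p \<in> M" for p
    proof -
      obtain x where x: "x \<in> K m" "p \<in> mball x (1 / real (Suc m))"
        using K(2)[of m] p by blast
      then have "(x, 1 / real (Suc m)) \<in> from_nat_into S ` J"
        using J(2) by blast
      then obtain n where "n \<in> J" "from_nat_into S n = (x, 1 / real (Suc m))"
        by (metis imageE)
      then show ?thesis
        using N m x by (metis fst_conv snd_conv)
    qed
    then show ?thesis by blast
  qed
  then show ?thesis
    using that[of "\<lambda>n. snd (from_nat_into S n)" "\<lambda>n. fst (from_nat_into S n)"] by simp
qed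

text \<open>The sets \<open>E\<close> below decrease to the topological boundary of \<open>A\<close>.\<close>

lemma small_near_boundary:
  assumes "finite_measure P" and sets: "sets P = sets (borel_of mtopology)"
    and A: "continuity_set mtopology P A" and "e > 0"
  obtains \<delta> E where "\<delta> > 0" "E \<in> sets P" "measure P E < e"
    "\<And>p a b. p \<in> M \<Longrightarrow> a \<in> A \<Longrightarrow> b \<in> M - A \<Longrightarrow> d a p < \<delta> \<Longrightarrow> d b p < \<delta> \<Longrightarrow> p \<in> E"
proof -
  interpret P: finite_measure P by fact
  have "space P = M"
    using sets_eq_imp_space_eq[OF sets] by (simp add: space_borel_of)
  have AM: "A \<subseteq> M"
    using A sets.sets_into_space[of A P] \<open>space P = M\<close> by (simp add: continuity_set_def)
  define E where "E n = (\<Union>a\<in>A. mball a (1 / real (Suc n))) \<inter> (\<Union>b\<in>M-A. mball b (1 / real (Suc n)))" for n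
  have meas: "E n \<in> sets P" for n
    unfolding sets E_def by (intro borel_of_sets_openin openin_Int openin_Union) auto
  have dec: "decseq E"
  proof (rule decseq_SucI)
    fix n
    have "1 / real (Suc (Suc n)) \<le> 1 / real (Suc n)"
      by (simp add: divide_simps)
    then show "E (Suc n) \<subseteq> E n"
      unfolding E_def using mball_subset_concentric by (fast intro: Int_mono UN_mono)
  qed
  have "(\<Inter>n. E n) \<subseteq> mtopology closure_of A - mtopology interior_of A"
  proof
    fix p assume p: "p \<in> (\<Inter>n. E n)"
    \<comment> \<open>A point of every \<open>E n\<close> is a limit of points of \<open>A\<close>
      and of points of \<open>M - A\<close>, hence lies in both closures; the interior is the
      complement of the second.\<close>
    have near: "\<exists>q\<in>B. q \<in> mball p \<rho>" if "\<rho> > 0" "B = A \<or> B = M - A" for \<rho> B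
    proof -
      obtain n where n: "1 / real (Suc n) < \<rho>"
        using \<open>\<rho> > 0\<close> nat_approx_posE by blast
      have "p \<in> E n"
        using p by blast
      then obtain q where "q \<in> B" "p \<in> mball q (1 / real (Suc n))"
        using \<open>B = A \<or> B = M - A\<close> unfolding E_def by blast
      then show ?thesis
        using n by (intro bexI[of _ q]) (auto simp: commute)
    qed
    have "p \<in> M"
      using p unfolding E_def by auto
    then have "p \<in> mtopology closure_of A" "p \<in> mtopology closure_of (M - A)"
      unfolding metric_closure_of using near by blast+
    then show "p \<in> mtopology closure_of A - mtopology interior_of A"
      by (simp add: interior_of_closure_of)
  qed
  \<comment> \<open>Monotonicity of the measure requires the larger set, the boundary, to be
    measurable.\<close>
  moreover have "mtopology closure_of A - mtopology interior_of A \<in> sets P"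
  proof -
    have "mtopology closure_of A - mtopology interior_of A
      = M - (M - mtopology closure_of A) - mtopology interior_of A"
      using closure_of_subset_topspace[of mtopology A] by auto
    moreover have "M - mtopology closure_of A \<in> sets P" "mtopology interior_of A \<in> sets P"
      unfolding sets
      by (intro borel_of_sets_openin; use openin_diff[OF openin_topspace closedin_closure_of, of mtopology A] in simp)+
    ultimately show ?thesis
      using sets.top[of P] \<open>space P = M\<close> by (metis sets.Diff)
  qed
  ultimately have "measure P (\<Inter>n. E n) \<le> 0"
    using A P.finite_measure_mono unfolding continuity_set_def by metis
  then have "measure P (\<Inter>n. E n) = 0"
    using measure_nonneg[of P "\<Inter>n. E n"] by linarith
  then have "(\<lambda>n. measure P (E n)) \<longlonglongrightarrow> 0"
    using P.finite_Lim_measure_decseq[of E] meas dec by (simp add: image_subset_iff)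
  then have "eventually (\<lambda>n. measure P (E n) < e) sequentially"
    using \<open>e > 0\<close> by (rule order_tendstoD)
  then obtain n where "measure P (E n) < e"
    by (auto simp: eventually_sequentially)
  then show ?thesis
    using AM by (intro that[of "1 / real (Suc n)" "E n"] meas) (auto simp: E_def)
qed

section \<open>The mapping and its uniform measurability\<close>

lemma exists_uniformly_measurable:
  assumes Y: "q_algebra Y" "density_on Y \<pi>" "darboux_on Y \<pi>"
    and compact: "compact_space mtopology"
    and P: "prob_space P" and sets: "sets P = sets (borel_of mtopology)"
  shows "\<exists>x. uniformly_measurable Y \<pi> mtopology P x"
proof -
  interpret P: prob_space P by fact
  have fp: "fin_add_prob Y \<pi>"
    using Y(2) by (simp add: density_on_def)
  have sp: "space P = M"
    using sets_eq_imp_space_eq[OF sets] by (simp add: space_borel_of)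
  have "M \<noteq> {}"
    using P.not_empty sp by simp
  with compact obtain r :: "nat \<Rightarrow> real" and c :: "nat \<Rightarrow> 'a"
    where cr: "\<forall>e>0. \<exists>N. \<forall>p\<in>M. \<exists>n<N. r n < e \<and> p \<in> mball (c n) (r n)"
    by (rule compact_ball_sequence)
  \<comment> \<open>Level \<open>n\<close> is cut by ball \<open>n\<close>, whatever set is being
    cut; only the tree in \<open>Y\<close> uses the second argument of the cutting function.\<close>
  define C where "C = branch (\<lambda>s _. mball (c (length s)) (r (length s))) M"
  have C_meas: "C s \<in> sets P" for s
  proof (induction s)
    case Nil
    show ?case
      using sets.top[of P] sp by (simp add: C_def)
  next
    case (Cons b s)
    have "mball (c (length s)) (r (length s)) \<in> sets P"
      unfolding sets by (intro borel_of_sets_openin openin_mball)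
    then show ?case
      using Cons by (auto simp: C_def)
  qed
  have C_sub: "C s \<subseteq> M" for s
    unfolding C_def by (rule branch_subset)
  have C_split: "C s = C (True # s) \<union> C (False # s)" "C (True # s) \<inter> C (False # s) = {}" for s
    by (auto simp: C_def)
  have "C [] = space P"
    by (simp add: C_def sp)
  then obtain h where h: "\<And>s. branch h UNIV s \<in> Y" "\<And>s. \<pi> (branch h UNIV s) = measure P (C s)"
    "\<And>s. C s = {} \<Longrightarrow> branch h UNIV s = {}"
    using darboux_tree[OF Y(1) fp Y(3) P C_meas _ C_split] by metis
  let ?D = "branch h UNIV"
  let ?cl = "\<lambda>s. mtopology closure_of (C s)"
  have "\<exists>p. p \<in> M \<and> (\<forall>s. k \<in> ?D s \<longrightarrow> p \<in> ?cl s)" for k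
  proof -
    have "\<exists>s. length s = n \<and> k \<in> ?D s" for n
      by (intro branch_cover) simp
    then obtain s where s: "\<And>n. length (s n) = n" "\<And>n. k \<in> ?D (s n)"
      by metis
    \<comment> \<open>Nodes of equal length are disjoint, so the nodes containing \<open>k\<close>
      form a single infinite branch and their cells are nested.\<close>
    have path: "t = s (length t)" if "k \<in> ?D t" for t
      using that s[of "length t"] branch_disjoint[of t "s (length t)" h UNIV] by auto
    have "decseq (\<lambda>n. ?cl (s n))"
    proof (rule decseq_SucI)
      fix n
      obtain b t where bt: "s (Suc n) = b # t" "length t = n"
        using s(1)[of "Suc n"] by (metis length_Suc_conv)
      then have "k \<in> ?D t"
        using s(2)[of "Suc n"] by (auto split: if_splits)
      then have "t = s n"
        using path bt(2) by blast
      then have "C (s (Suc n)) \<subseteq> C (s n)"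
        using bt(1) by (auto simp: C_def)
      then show "?cl (s (Suc n)) \<subseteq> ?cl (s n)"
        by (rule closure_of_mono)
    qed
    \<comment> \<open>\<open>k\<close> witnesses that the node is nonempty, so its cell is nonempty
      too, even if null.\<close>
    moreover have "?cl (s n) \<noteq> {}" for n
      using h(3)[of "s n"] s(2)[of n] C_sub[of "s n"] by (auto simp: closure_of_eq_empty)
    ultimately have "(\<Inter>n. ?cl (s n)) \<noteq> {}"
      by (intro compact_space_imp_nest[OF compact]) auto
    then obtain p where "\<And>n. p \<in> ?cl (s n)"
      by blast
    then show ?thesis
      using path closure_of_subset_topspace[of mtopology] by (metis subsetD topspace_mtopology)
  qed
  then obtain x where x: "\<And>k. x k \<in> M" "\<And>k s. k \<in> ?D s \<Longrightarrow> x k \<in> ?cl s"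
    by metis
  \<comment> \<open>One level has finitely many disjoint cells, so finite additivity of
    \<open>\<pi>\<close> suffices to transfer masses.\<close>
  have level: "(\<Union>s\<in>I. ?D s) \<in> Y \<and> \<pi> (\<Union>s\<in>I. ?D s) = measure P (\<Union>s\<in>I. C s)"
    if I: "I \<subseteq> {s. length s = N}" for I N
  proof -
    have fin: "finite I"
      using I finite_bool_lists finite_subset by blast
    have disjC: "disjoint_family_on C I"
      unfolding C_def by (rule disjoint_family_on_branch[OF I])
    have "measure P (\<Union>s\<in>I. C s) = (\<Sum>s\<in>I. measure P (C s))"
      using P.finite_measure_finite_Union[OF fin _ disjC] C_meas by blast
    moreover have "disjoint_family_on ?D I"
      by (rule disjoint_family_on_branch[OF I])
    ultimately show ?thesis
      using fin_add_prob_UN[OF Y(1) fp fin, of ?D] h by simp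
  qed
  \<comment> \<open>The last two inequalities make the same bounds trap \<open>measure P A\<close>,
    which later identifies the value of \<open>\<pi>\<close>.\<close>
  have sandwich: "\<exists>A1\<in>Y. \<exists>A2\<in>Y. A1 \<subseteq> x -` A \<and> x -` A \<subseteq> A2 \<and> \<pi> A2 - \<pi> A1 < e
      \<and> \<pi> A1 \<le> measure P A \<and> measure P A \<le> \<pi> A2"
    if A: "continuity_set mtopology P A" and "e > 0" for A e
  proof -
    have AP: "A \<in> sets P"
      using A by (simp add: continuity_set_def)
    then have AM: "A \<subseteq> M"
      using sets.sets_into_space sp by blast
    obtain \<delta> E where E: "\<delta> > 0" "E \<in> sets P" "measure P E < e"
      "\<And>p a b. p \<in> M \<Longrightarrow> a \<in> A \<Longrightarrow> b \<in> M - A \<Longrightarrow> d a p < \<delta> \<Longrightarrow> d b p < \<delta> \<Longrightarrow> p \<in> E"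
      by (rule small_near_boundary[OF P.finite_measure_axioms sets A \<open>e > 0\<close>]) blast
    \<comment> \<open>Radius below \<open>\<delta> / 2\<close> gives diameter below
      \<open>\<delta>\<close>, also after taking closures.\<close>
    obtain N where N: "\<forall>p\<in>M. \<exists>n<N. r n < \<delta> / 2 \<and> p \<in> mball (c n) (r n)"
      using cr E(1) half_gt_zero by blast
    have small: "d q p < \<delta>" if "length s = N" "p \<in> C s" "q \<in> ?cl s" for s p q
    proof -
      have "p \<in> M"
        using that(2) C_sub by blast
      then obtain n where n: "n < N" "r n < \<delta> / 2" "p \<in> mball (c n) (r n)"
        using N by blast
      \<comment> \<open>Ball \<open>n\<close> is the cut from length \<open>n\<close> to
        \<open>n + 1\<close>. As \<open>n < N\<close>, the cell lies inside this ball or misses it,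
        and \<open>p\<close> rules out the latter.\<close>
      have "C s \<subseteq> mball (c n) (r n)"
        using that(1,2) n(1,3)
      proof (induction s arbitrary: N)
        case (Cons b s)
        then show ?case
          by (cases "length s = n") (auto simp: C_def split: if_splits)
      qed simp
      then have "?cl s \<subseteq> mtopology closure_of mcball (c n) (r n)"
        by (intro closure_of_mono) (use mball_subset_mcball in blast)
      then have "q \<in> mcball (c n) (r n)"
        using that(3) closure_of_closedin[OF closedin_mcball] by auto
      then show ?thesis
        using n triangle[of q "c n" p] by (auto simp: commute)
    qed
    \<comment> \<open>\<open>x k\<close> is known to lie only in the closure of its cells, so
      closures decide between inner and outer approximation.\<close>
    define L where "L = {s. length s = N \<and> ?cl s \<subseteq> A}"
    define U where "U = {s. length s = N \<and> ?cl s \<inter> A \<noteq> {}}"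
    have C_cl: "C s \<subseteq> ?cl s" for s
      using C_sub by (simp add: closure_of_subset)
    have cl_M: "?cl s \<subseteq> M" for s
      using closure_of_subset_topspace[of mtopology] by simp
    have lev: "(\<Union>s\<in>L. ?D s) \<in> Y" "\<pi> (\<Union>s\<in>L. ?D s) = measure P (\<Union>s\<in>L. C s)"
      "(\<Union>s\<in>U. ?D s) \<in> Y" "\<pi> (\<Union>s\<in>U. ?D s) = measure P (\<Union>s\<in>U. C s)"
      using level[of L N] level[of U N] by (auto simp: L_def U_def)
    have meas: "(\<Union>s\<in>L. C s) \<in> sets P" "(\<Union>s\<in>U. C s) \<in> sets P"
      using finite_bool_lists[of N] C_meas
      by (auto simp: L_def U_def intro!: sets.finite_UN elim: rev_finite_subset)
    \<comment> \<open>A cell in \<open>U\<close> but not in \<open>L\<close> has points of both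
      \<open>A\<close> and \<open>M - A\<close> in its closure; being small, it lies in
      \<open>E\<close>.\<close>
    have "(\<Union>s\<in>U. C s) \<subseteq> (\<Union>s\<in>L. C s) \<union> E"
    proof
      fix p assume "p \<in> (\<Union>s\<in>U. C s)"
      then obtain s a where s: "length s = N" "p \<in> C s" "a \<in> ?cl s" "a \<in> A"
        unfolding U_def by blast
      show "p \<in> (\<Union>s\<in>L. C s) \<union> E"
      proof (cases "?cl s \<subseteq> A")
        case True
        then show ?thesis
          using s by (auto simp: L_def)
      next
        case False
        then obtain b where "b \<in> ?cl s" "b \<in> M - A"
          using cl_M by blast
        then show ?thesis
          using E(4)[of p a b] small s C_sub by blast
      qed
    qed
    then have "measure P (\<Union>s\<in>U. C s) \<le> measure P ((\<Union>s\<in>L. C s) \<union> E)"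
      using meas E(2) by (intro P.finite_measure_mono) auto
    also have "\<dots> \<le> measure P (\<Union>s\<in>L. C s) + measure P E"
      using meas E(2) by (intro measure_Un_le) auto
    finally have "\<pi> (\<Union>s\<in>U. ?D s) - \<pi> (\<Union>s\<in>L. ?D s) < e"
      using E(3) lev by simp
    moreover have "(\<Union>s\<in>L. ?D s) \<subseteq> x -` A"
      using x(2) by (auto simp: L_def)
    moreover have "x -` A \<subseteq> (\<Union>s\<in>U. ?D s)"
    proof
      fix k assume k: "k \<in> x -` A"
      obtain s where "length s = N" "k \<in> ?D s"
        using branch_cover[of k UNIV N h] by blast
      then show "k \<in> (\<Union>s\<in>U. ?D s)"
        using k x(2)[of k s] by (auto simp: U_def)
    qed
    moreover have "measure P (\<Union>s\<in>L. C s) \<le> measure P A"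
      using C_cl AP by (intro P.finite_measure_mono) (auto simp: L_def)
    moreover have "measure P A \<le> measure P (\<Union>s\<in>U. C s)"
    proof (rule P.finite_measure_mono[OF _ meas(2)])
      show "A \<subseteq> (\<Union>s\<in>U. C s)"
      proof
        fix p assume "p \<in> A"
        moreover obtain s where "length s = N" "p \<in> C s"
          using branch_cover[of p M N] \<open>p \<in> A\<close> AM unfolding C_def by blast
        ultimately show "p \<in> (\<Union>s\<in>U. C s)"
          using C_cl by (auto simp: U_def)
      qed
    qed
    ultimately show ?thesis
      using lev by (intro bexI[of _ "\<Union>s\<in>L. ?D s"] bexI[of _ "\<Union>s\<in>U. ?D s"]) auto
  qed
  have "x -` A \<in> Y \<and> \<pi> (x -` A) = measure P A" if A: "continuity_set mtopology P A" for A
  proof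
    \<comment> \<open>The sandwich is the membership criterion in the definition of a density. Only
      after this does monotonicity of \<open>\<pi>\<close> apply to the preimage.\<close>
    show inY: "x -` A \<in> Y"
    proof -
      have "\<forall>e>0. \<exists>A1\<in>Y. \<exists>A2\<in>Y. A1 \<subseteq> x -` A \<and> x -` A \<subseteq> A2 \<and> \<pi> A2 - \<pi> A1 < e"
        using sandwich[OF A] by meson
      then show ?thesis
        using Y(2) unfolding density_on_def by (elim conjE allE[of _ "x -` A"]) simp
    qed
    \<comment> \<open>Both numbers lie between \<open>\<pi> A1\<close> and
      \<open>\<pi> A2\<close>.\<close>
    have "\<bar>\<pi> (x -` A) - measure P A\<bar> < e" if e: "e > 0" for e
    proof -
      obtain A1 A2 where A12: "A1 \<in> Y" "A2 \<in> Y" "A1 \<subseteq> x -` A" "x -` A \<subseteq> A2"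
        "\<pi> A2 - \<pi> A1 < e" "\<pi> A1 \<le> measure P A" "measure P A \<le> \<pi> A2"
        using sandwich[OF A e] by blast
      then show ?thesis
        using fin_add_prob_mono[OF Y(1) fp A12(1) inY] fin_add_prob_mono[OF Y(1) fp inY A12(2)]
        by linarith
    qed
    then show "\<pi> (x -` A) = measure P A"
      by (metis less_irrefl zero_less_abs_iff right_minus_eq)
  qed
  then have "uniformly_measurable Y \<pi> mtopology P x"
    using x(1) by (auto simp: uniformly_measurable_def)
  then show ?thesis by blast
qed

end

theorem theorem4:
  fixes Y :: "nat set set" and \<pi> :: "nat set \<Rightarrow> real"
    and M :: "'a set" and d :: "'a \<Rightarrow> 'a \<Rightarrow> real" and P :: "'a measure"
  assumes "q_algebra Y" and "density_on Y \<pi>" and "darboux_on Y \<pi>"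
    and "Metric_space M d" and "compact_space (Metric_space.mtopology M d)"
    and "prob_space P" and "sets P = sets (borel_of (Metric_space.mtopology M d))"
  shows "\<exists>x. uniformly_measurable Y \<pi> (Metric_space.mtopology M d) P x"
  using Metric_space.exists_uniformly_measurable[OF assms(4,1-3,5-7)] .

end
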